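(* Let $\{X_k,\mathcal{F}_k\}_{k\ge 0}$ be a discrete-time, real-valued, conditionally symmetric martingale. Let $m\ge 2$ be an even integer, let $d>0$, and let $\mu_2,\mu_4,\ldots,\mu_m$ be non-negative numbers such that, almost surely, for every integer $k\ge1$, $$|X_k-X_{k-1}|\le d,\qquad \mathbb{E}\big[(X_k-X_{k-1})^l\mid\mathcal{F}_{k-1}\big]\le\mu_l\quad\text{for all } l\in\{2,4,\ldots,m\}.$$ Then for every real $\alpha\ge0$ and every integer $n\ge1$, $$\mathbb{P}\Big(\max_{1\le k\le n}|X_k-X_0|\ge\alpha n\Big)\le 2\left\{\inf_{x\ge0}\,e^{-\delta x}\left[1+\sum_{l=1}^{\frac m2-1}\frac{(\gamma_{2l}-\gamma_m)\,x^{2l}}{(2l)!}+\gamma_m\big(\cosh(x)-1\big)\right]\right\}^n,$$ where $\delta=\alpha/d$ and $\gamma_{2l}=\mu_{2l}/d^{2l}$ for $l\in\{1,\ldots,m/2\}$ (the sum being empty when $m=2$).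
   Context: A discrete-time real-valued martingale $\{X_k,\mathcal{F}_k\}_{k\ge0}$ with jumps $\xi_k=X_k-X_{k-1}$, $k\ge1$, is called conditionally symmetric if, for every $k\ge 1$, conditioned on $\mathcal{F}_{k-1}$, the random variable $\xi_k$ is symmetrically distributed around zero (i.e. $\xi_k$ and $-\xi_k$ have the same conditional law given $\mathcal{F}_{k-1}$). *)

theory Defs
  imports "HOL-Probability.Probability"
begin

locale discrete_martingale = prob_space M + filtration "space M" F
  for M :: "'a measure" and F :: "nat \<Rightarrow> 'a measure" +
  fixes X :: "nat \<Rightarrow> 'a \<Rightarrow> real"
  assumes subalgebra_F: "\<And>k. subalgebra M (F k)"
    and adapted: "\<And>k. X k \<in> borel_measurable (F k)"
    and integrable_X: "\<And>k. integrable M (X k)"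
    and martingale_property:
      "\<And>k. k \<ge> 1 \<Longrightarrow> AE \<omega> in M. real_cond_exp M (F (k - 1)) (X k) \<omega> = X (k - 1) \<omega>"

text \<open>Conditional probability of the event \<open>Y \<in> B\<close> given the sub-sigma-algebra \<open>G\<close>.
  As a function of \<open>\<omega>\<close> it is only determined up to null sets.\<close>

definition cond_law :: "'a measure \<Rightarrow> 'a measure \<Rightarrow> ('a \<Rightarrow> real) \<Rightarrow> real set \<Rightarrow> 'a \<Rightarrow> real" where
  "cond_law M G Y B = real_cond_exp M G (\<lambda>\<omega>. indicator B (Y \<omega>))"

text \<open>The exceptional null set may depend on \<open>B\<close>, because \<open>cond_law\<close> uses an arbitrary
  version of each conditional probability; on the real line this is equivalent to equality of
  the regular conditional distributions outside a single null set.\<close>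

definition same_cond_law ::
  "'a measure \<Rightarrow> 'a measure \<Rightarrow> ('a \<Rightarrow> real) \<Rightarrow> ('a \<Rightarrow> real) \<Rightarrow> bool" where
  "same_cond_law M G Y Z \<longleftrightarrow>
     (\<forall>B \<in> sets borel. AE \<omega> in M. cond_law M G Y B \<omega> = cond_law M G Z B \<omega>)"

locale cond_symmetric_martingale = discrete_martingale M F X
  for M :: "'a measure" and F :: "nat \<Rightarrow> 'a measure" and X :: "nat \<Rightarrow> 'a \<Rightarrow> real" +
  assumes cond_symmetric:
    "\<And>k. k \<ge> 1 \<Longrightarrow>
       same_cond_law M (F (k - 1)) (\<lambda>\<omega>. X k \<omega> - X (k - 1) \<omega>) (\<lambda>\<omega>. - (X k \<omega> - X (k - 1) \<omega>))"

end

theory Submission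
  imports Defs
begin

text \<open>
  The bound comes from the exponential (Chernoff) method. Let \<open>\<xi>\<close> be a jump and put \<open>x = t * d\<close>,
  \<open>u = \<xi> / d\<close>, so that \<open>\<bar>u\<bar> \<le> 1\<close>. By conditional symmetry \<open>exp (t * \<xi>)\<close> and \<open>cosh (t * \<xi>) = cosh (x * u)\<close>
  have the same conditional expectation, so only even powers of \<open>u\<close> matter. In the power series of
  \<open>cosh (x * u)\<close> every power \<open>u ^ (2 * l)\<close> with \<open>2 * l \<ge> m\<close> is at most \<open>u ^ m\<close>; hence the whole tail
  of the series is at most \<open>u ^ m\<close> times the tail of \<open>cosh x\<close>
  (\<open>cosh_le_cosh_moment_bound\<close>). The resulting majorant involves \<open>u\<close> only through its even moments
  up to order \<open>m\<close>, with non-negative coefficients, and the moment hypotheses turn it into the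
  bracket \<open>B\<close> of the theorem (\<open>integral_exp_symmetric_le\<close>).

  It follows that \<open>exp (t * (X k - X 0)) / B ^ k\<close> is a non-negative supermartingale with initial value
  \<open>1\<close>. Because \<open>B \<ge> 1\<close>, whenever \<open>t * (X k - X 0) \<ge> a\<close> for some \<open>k \<le> n\<close>, this supermartingale has
  reached the level \<open>exp a / B ^ n\<close>; the maximal inequality bounds the probability by
  \<open>exp (- a) * B ^ n\<close> (\<open>one_sided_maximal_inequality\<close>). The two signs of \<open>t\<close> take care of the
  absolute value and give the factor \<open>2\<close>. The bound holds for each \<open>x \<ge> 0\<close> separately, and taking
  \<open>n\<close>-th roots carries it over to the infimum.
\<close>

section \<open>A majorant of the hyperbolic cosine in terms of even moments\<close>

definition cosh_tail :: "nat \<Rightarrow> real \<Rightarrow> real" where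
  "cosh_tail p x = cosh x - (\<Sum>l<p. x ^ (2 * l) / fact (2 * l))"

definition cosh_moment_bound :: "nat \<Rightarrow> (nat \<Rightarrow> real) \<Rightarrow> real \<Rightarrow> real" where
  "cosh_moment_bound p \<gamma> x =
     1 + (\<Sum>l=1..p - 1. (\<gamma> (2 * l) - \<gamma> (2 * p)) * x ^ (2 * l) / fact (2 * l))
       + \<gamma> (2 * p) * (cosh x - 1)"

lemma sum_lessThan_split_zero:
  fixes f :: "nat \<Rightarrow> real"
  assumes "p \<ge> 1"
  shows "(\<Sum>l<p. f l) = f 0 + (\<Sum>l=1..p - 1. f l)"
proof -
  have "{..<p} = insert 0 {1..p - 1}" using assms by auto
  then show ?thesis by simp
qed

lemma cosh_tail_sums:
  "(\<lambda>l. x ^ (2 * (l + p)) / fact (2 * (l + p))) sums cosh_tail p x"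
proof -
  have "(\<lambda>l. if even (2 * l) then x ^ (2 * l) /\<^sub>R fact (2 * l) else 0) sums cosh x"
    using cosh_converges[of x]
    by (subst sums_mono_reindex[where g = "\<lambda>l. 2 * l"])
       (auto simp: strict_mono_def elim!: evenE)
  then have "(\<lambda>l. x ^ (2 * l) / fact (2 * l)) sums cosh x"
    by (simp add: divide_inverse mult.commute)
  then show ?thesis
    unfolding cosh_tail_def by (rule sums_split_initial_segment)
qed

lemma cosh_tail_nonneg: "cosh_tail p x \<ge> 0"
  by (rule sums_le[OF _ sums_zero cosh_tail_sums]) (simp add: zero_le_even_power)

text \<open>Term by term, each power of \<open>u\<^sup>2\<close> beyond the \<open>p\<close>-th only makes the term smaller.\<close>

lemma cosh_tail_scale_le:
  assumes "\<bar>u\<bar> \<le> 1"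
  shows "cosh_tail p (x * u) \<le> u ^ (2 * p) * cosh_tail p x"
proof (rule sums_le[OF _ cosh_tail_sums sums_mult[OF cosh_tail_sums]])
  fix l
  have "u ^ (2 * l) \<le> 1"
    using assms by (simp add: power_mult abs_square_le_1 power_le_one)
  then have "u ^ (2 * l) * (u ^ (2 * p) * (x ^ (2 * (l + p)) / fact (2 * (l + p))))
      \<le> 1 * (u ^ (2 * p) * (x ^ (2 * (l + p)) / fact (2 * (l + p))))"
    by (rule mult_right_mono) (simp add: zero_le_even_power)
  then show "(x * u) ^ (2 * (l + p)) / fact (2 * (l + p))
      \<le> u ^ (2 * p) * (x ^ (2 * (l + p)) / fact (2 * (l + p)))"
    by (simp add: power_mult_distrib power_add distrib_left mult_ac)
qed

text \<open>Grouping the terms by the moments instead of by the powers of \<open>x\<close> shows that the bound is affine in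
  \<open>\<gamma>\<close> with non-negative coefficients. This is what allows both monotonicity in the moments and
  integration term by term, neither of which is visible from the differences
  \<open>\<gamma> (2 * l) - \<gamma> (2 * p)\<close>, whose signs are arbitrary.\<close>

lemma cosh_moment_bound_altdef:
  assumes "p \<ge> 1"
  shows "cosh_moment_bound p \<gamma> x =
    1 + (\<Sum>l=1..p - 1. \<gamma> (2 * l) * (x ^ (2 * l) / fact (2 * l))) + \<gamma> (2 * p) * cosh_tail p x"
  unfolding cosh_moment_bound_def cosh_tail_def sum_lessThan_split_zero[OF assms]
  by (simp add: left_diff_distrib right_diff_distrib distrib_left diff_divide_distrib
      sum_subtractf sum_distrib_left)

text \<open>Only the tail of the series is estimated, so no information on the moments below \<open>2 * p\<close> is lost.\<close>

lemma cosh_le_cosh_moment_bound: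
  assumes "p \<ge> 1" "\<bar>u\<bar> \<le> 1"
  shows "cosh (x * u) \<le> cosh_moment_bound p (\<lambda>j. u ^ j) x"
proof -
  have "cosh (x * u) = (\<Sum>l<p. (x * u) ^ (2 * l) / fact (2 * l)) + cosh_tail p (x * u)"
    by (simp add: cosh_tail_def)
  also have "\<dots> \<le> (\<Sum>l<p. (x * u) ^ (2 * l) / fact (2 * l)) + u ^ (2 * p) * cosh_tail p x"
    using cosh_tail_scale_le[OF assms(2)] by simp
  also have "\<dots> = cosh_moment_bound p (\<lambda>j. u ^ j) x"
    unfolding cosh_moment_bound_altdef[OF assms(1)] sum_lessThan_split_zero[OF assms(1)]
    by (simp add: power_mult_distrib mult_ac)
  finally show ?thesis .
qed

lemma cosh_moment_bound_ge_1:
  assumes "p \<ge> 1" "\<And>l. l \<in> {1..p} \<Longrightarrow> \<gamma> (2 * l) \<ge> 0"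
  shows "cosh_moment_bound p \<gamma> x \<ge> 1"
  unfolding cosh_moment_bound_altdef[OF assms(1)]
  using assms by (auto intro!: add_nonneg_nonneg sum_nonneg mult_nonneg_nonneg
      simp: cosh_tail_nonneg power_mult)

section \<open>Conditionally symmetric random variables\<close>

context sigma_finite_subalgebra
begin

text \<open>Statements about conditional expectations given \<open>F\<close> are expressed below by integrals against
  non-negative \<open>F\<close>-measurable weights \<open>g\<close>. Integrability is then needed only for products with \<open>g\<close>,
  and no version of a conditional expectation has to be chosen.\<close>

lemma integral_mult_le_of_cond_exp_le:
  assumes g[measurable]: "g \<in> borel_measurable F"
    and g_nonneg: "\<And>\<omega>. g \<omega> \<ge> 0" and g_int: "integrable M g"
    and f[measurable]: "f \<in> borel_measurable M" and gf: "integrable M (\<lambda>\<omega>. g \<omega> * f \<omega>)"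
    and le: "AE \<omega> in M. real_cond_exp M F f \<omega> \<le> c"
  shows "(\<integral>\<omega>. g \<omega> * f \<omega> \<partial>M) \<le> c * (\<integral>\<omega>. g \<omega> \<partial>M)"
proof -
  have "(\<integral>\<omega>. g \<omega> * f \<omega> \<partial>M) = (\<integral>\<omega>. g \<omega> * real_cond_exp M F f \<omega> \<partial>M)"
    using real_cond_exp_intg(2)[OF gf g f] by simp
  also have "\<dots> \<le> (\<integral>\<omega>. c * g \<omega> \<partial>M)"
  proof (rule integral_mono_AE)
    show "integrable M (\<lambda>\<omega>. g \<omega> * real_cond_exp M F f \<omega>)"
      by (rule real_cond_exp_intg(1)[OF gf g f])
    show "AE \<omega> in M. g \<omega> * real_cond_exp M F f \<omega> \<le> c * g \<omega>"
      using le by eventually_elim (metis g_nonneg mult.commute mult_left_mono)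
  qed (use g_int in simp)
  finally show ?thesis by simp
qed

text \<open>The image measures of \<open>g dM\<close> under \<open>Y\<close> and \<open>Z\<close> coincide: on each Borel set \<open>B\<close> they are the integral
  of \<open>g\<close> times the conditional probability of \<open>B\<close>. Since the sets are compared one at a time, it is
  harmless that the null set in the definition of equal conditional laws may depend on \<open>B\<close>.
  Equality of the image measures then extends from indicators to all non-negative test functions.\<close>

lemma same_cond_law_nn_integral:
  assumes same: "same_cond_law M F Y Z"
    and [measurable]: "Y \<in> borel_measurable M" "Z \<in> borel_measurable M"
    and g[measurable]: "g \<in> borel_measurable F"
    and g_nonneg: "\<And>\<omega>. g \<omega> \<ge> 0" and g_int: "integrable M g"
    and h[measurable]: "h \<in> borel_measurable borel"
  shows "(\<integral>\<^sup>+\<omega>. ennreal (g \<omega>) * h (Y \<omega>) \<partial>M) = (\<integral>\<^sup>+\<omega>. ennreal (g \<omega>) * h (Z \<omega>) \<partial>M)"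
proof -
  have gM[measurable]: "g \<in> borel_measurable M"
    using subalg g by (rule measurable_from_subalg)
  have "distr (density M g) borel Y = distr (density M g) borel Z"
  proof (rule measure_eqI)
    fix B assume "B \<in> sets (distr (density M g) borel Y)"
    then have B[measurable]: "B \<in> sets borel" by simp
    have int: "integrable M (\<lambda>\<omega>. g \<omega> * indicator B (V \<omega>))"
      if [measurable]: "V \<in> borel_measurable M" for V :: "'a \<Rightarrow> real"
      by (rule Bochner_Integration.integrable_bound[OF g_int]) (auto split: split_indicator)
    have cond: "(\<integral>\<omega>. g \<omega> * indicator B (V \<omega>) \<partial>M) = (\<integral>\<omega>. g \<omega> * cond_law M F V B \<omega> \<partial>M)"
      if [measurable]: "V \<in> borel_measurable M" for V :: "'a \<Rightarrow> real"
      unfolding cond_law_def by (subst real_cond_exp_intg(2)) (auto intro: int)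
    have "(\<integral>\<omega>. g \<omega> * indicator B (Y \<omega>) \<partial>M) = (\<integral>\<omega>. g \<omega> * indicator B (Z \<omega>) \<partial>M)"
      unfolding cond[OF assms(2)] cond[OF assms(3)]
    proof (rule integral_cong_AE)
      show "AE \<omega> in M. g \<omega> * cond_law M F Y B \<omega> = g \<omega> * cond_law M F Z B \<omega>"
        using same B unfolding same_cond_law_def by (auto elim!: eventually_mono)
    qed (auto simp: cond_law_def)
    moreover have "emeasure (distr (density M g) borel V) B
        = ennreal (\<integral>\<omega>. g \<omega> * indicator B (V \<omega>) \<partial>M)"
      if [measurable]: "V \<in> borel_measurable M" for V :: "'a \<Rightarrow> real"
    proof -
      have "emeasure (distr (density M g) borel V) B
          = (\<integral>\<^sup>+\<omega>. ennreal (g \<omega>) * indicator (V -` B \<inter> space M) \<omega> \<partial>M)"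
        by (simp add: emeasure_distr emeasure_density)
      also have "\<dots> = (\<integral>\<^sup>+\<omega>. ennreal (g \<omega> * indicator B (V \<omega>)) \<partial>M)"
        by (rule nn_integral_cong) (auto split: split_indicator)
      also have "\<dots> = ennreal (\<integral>\<omega>. g \<omega> * indicator B (V \<omega>) \<partial>M)"
        by (rule nn_integral_eq_integral) (auto intro: int simp: g_nonneg)
      finally show ?thesis .
    qed
    ultimately show "emeasure (distr (density M g) borel Y) B = emeasure (distr (density M g) borel Z) B"
      by simp
  qed simp
  then have "(\<integral>\<^sup>+y. h y \<partial>distr (density M g) borel Y) = (\<integral>\<^sup>+y. h y \<partial>distr (density M g) borel Z)"
    by simp
  then show ?thesis
    by (simp add: nn_integral_distr nn_integral_density)
qed

text \<open>The one-step estimate: a weight of the form \<open>exp (t * (X k - X 0))\<close>, restricted to an event of the past,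
  grows in expectation by at most the factor \<open>cosh_moment_bound\<close> when the next jump is added.\<close>

lemma integral_exp_symmetric_le:
  assumes sym: "same_cond_law M F \<xi> (\<lambda>\<omega>. - \<xi> \<omega>)"
    and \<xi>[measurable]: "\<xi> \<in> borel_measurable M"
    and d: "d > 0" and bdd: "AE \<omega> in M. \<bar>\<xi> \<omega>\<bar> \<le> d"
    and p: "p \<ge> 1"
    and mom: "\<And>l. l \<in> {1..p} \<Longrightarrow> AE \<omega> in M. real_cond_exp M F (\<lambda>\<omega>. \<xi> \<omega> ^ (2 * l)) \<omega> \<le> \<mu> (2 * l)"
    and g[measurable]: "g \<in> borel_measurable F"
    and g_nonneg: "\<And>\<omega>. g \<omega> \<ge> 0" and g_int: "integrable M g"
  shows "integrable M (\<lambda>\<omega>. g \<omega> * exp (t * \<xi> \<omega>))"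
    and "(\<integral>\<omega>. g \<omega> * exp (t * \<xi> \<omega>) \<partial>M)
      \<le> cosh_moment_bound p (\<lambda>j. \<mu> j / d ^ j) (t * d) * (\<integral>\<omega>. g \<omega> \<partial>M)"
proof -
  have gM[measurable]: "g \<in> borel_measurable M"
    using subalg g by (rule measurable_from_subalg)
  have exp_int: "integrable M (\<lambda>\<omega>. g \<omega> * exp (s * \<xi> \<omega>))" for s
  proof (rule Bochner_Integration.integrable_bound[of _ "\<lambda>\<omega>. exp (\<bar>s\<bar> * d) * g \<omega>"])
    show "AE \<omega> in M. norm (g \<omega> * exp (s * \<xi> \<omega>)) \<le> norm (exp (\<bar>s\<bar> * d) * g \<omega>)"
      using bdd
    proof eventually_elim
      case (elim \<omega>)
      have "s * \<xi> \<omega> \<le> \<bar>s\<bar> * \<bar>\<xi> \<omega>\<bar>" by (metis abs_ge_self abs_mult)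
      also have "\<dots> \<le> \<bar>s\<bar> * d" using elim by (simp add: mult_left_mono)
      finally show ?case
        by (simp add: g_nonneg abs_mult mult_left_mono mult.commute[of "exp _"])
    qed
  qed (use g_int in auto)
  show "integrable M (\<lambda>\<omega>. g \<omega> * exp (t * \<xi> \<omega>))" by (rule exp_int)
  have pow_int: "integrable M (\<lambda>\<omega>. g \<omega> * \<xi> \<omega> ^ l)" for l
  proof (rule Bochner_Integration.integrable_bound[of _ "\<lambda>\<omega>. d ^ l * g \<omega>"])
    show "AE \<omega> in M. norm (g \<omega> * \<xi> \<omega> ^ l) \<le> norm (d ^ l * g \<omega>)"
      using bdd
    proof eventually_elim
      case (elim \<omega>)
      have "\<bar>\<xi> \<omega>\<bar> ^ l \<le> d ^ l" using elim by (intro power_mono) auto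
      then show ?case
        using d by (simp add: g_nonneg abs_mult power_abs mult_left_mono mult.commute[of "d ^ l"])
    qed
  qed (use g_int in auto)
  let ?E = "\<lambda>f. (\<integral>\<omega>. g \<omega> * f \<omega> \<partial>M)"
  let ?b = "\<lambda>l. (t * d) ^ (2 * l) / fact (2 * l)"
  \<comment> \<open>Test functions of conditional laws are non-negative, so the symmetry is first used for
    \<open>nn_integral\<close> and then transferred to the Bochner integral.\<close>
  have reflect: "?E (\<lambda>\<omega>. exp (t * \<xi> \<omega>)) = ?E (\<lambda>\<omega>. exp (- t * \<xi> \<omega>))"
  proof -
    have "(\<integral>\<^sup>+\<omega>. ennreal (g \<omega>) * ennreal (exp (t * \<xi> \<omega>)) \<partial>M)
        = (\<integral>\<^sup>+\<omega>. ennreal (g \<omega>) * ennreal (exp (t * (- \<xi> \<omega>))) \<partial>M)"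
      by (rule same_cond_law_nn_integral[OF sym, where h = "\<lambda>y. ennreal (exp (t * y))"])
         (auto simp: g_nonneg g_int)
    moreover have eq: "ennreal (?E (\<lambda>\<omega>. exp (s * \<xi> \<omega>)))
        = (\<integral>\<^sup>+\<omega>. ennreal (g \<omega>) * ennreal (exp (s * \<xi> \<omega>)) \<partial>M)" for s
      using exp_int by (subst nn_integral_eq_integral[symmetric]) (auto simp: g_nonneg ennreal_mult)
    ultimately have "ennreal (?E (\<lambda>\<omega>. exp (t * \<xi> \<omega>))) = ennreal (?E (\<lambda>\<omega>. exp (- t * \<xi> \<omega>)))"
      unfolding eq by simp
    then show ?thesis
      by (subst (asm) ennreal_inj) (simp_all add: g_nonneg)
  qed
  have "?E (\<lambda>\<omega>. exp (t * \<xi> \<omega>)) = (?E (\<lambda>\<omega>. exp (t * \<xi> \<omega>)) + ?E (\<lambda>\<omega>. exp (- t * \<xi> \<omega>))) / 2"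
    using reflect by simp
  also have "\<dots> = (\<integral>\<omega>. g \<omega> * exp (t * \<xi> \<omega>) + g \<omega> * exp (- t * \<xi> \<omega>) \<partial>M) / 2"
    by (subst Bochner_Integration.integral_add[OF exp_int exp_int]) simp
  also have "\<dots> \<le> (\<integral>\<omega>. g \<omega> + (\<Sum>l=1..p - 1. (g \<omega> * \<xi> \<omega> ^ (2 * l)) * (?b l / d ^ (2 * l)))
        + (g \<omega> * \<xi> \<omega> ^ (2 * p)) * (cosh_tail p (t * d) / d ^ (2 * p)) \<partial>M)"
    (is "_ \<le> (\<integral>\<omega>. ?R \<omega> \<partial>M)")
  proof -
    have "(\<integral>\<omega>. (g \<omega> * exp (t * \<xi> \<omega>) + g \<omega> * exp (- t * \<xi> \<omega>)) / 2 \<partial>M) \<le> (\<integral>\<omega>. ?R \<omega> \<partial>M)"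
    proof (rule integral_mono_AE)
      show "AE \<omega> in M. (g \<omega> * exp (t * \<xi> \<omega>) + g \<omega> * exp (- t * \<xi> \<omega>)) / 2 \<le> ?R \<omega>"
        using bdd
      proof eventually_elim
        case (elim \<omega>)
        have "(g \<omega> * exp (t * \<xi> \<omega>) + g \<omega> * exp (- t * \<xi> \<omega>)) / 2
            = g \<omega> * cosh ((t * d) * (\<xi> \<omega> / d))"
          using d by (simp add: cosh_def field_simps)
        also have "\<dots> \<le> g \<omega> * cosh_moment_bound p (\<lambda>j. (\<xi> \<omega> / d) ^ j) (t * d)"
          using elim d by (intro mult_left_mono cosh_le_cosh_moment_bound p) (auto simp: g_nonneg)
        also have "\<dots> = ?R \<omega>"
          unfolding cosh_moment_bound_altdef[OF p]
          by (simp add: distrib_left sum_distrib_left power_divide mult_ac)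
        finally show ?case .
      qed
    qed (intro Bochner_Integration.integrable_add Bochner_Integration.integrable_sum
        integrable_mult_left integrable_divide exp_int pow_int g_int)+
    then show ?thesis by simp
  qed
  also have "\<dots> = ?E (\<lambda>_. 1) + (\<Sum>l=1..p - 1. ?E (\<lambda>\<omega>. \<xi> \<omega> ^ (2 * l)) * (?b l / d ^ (2 * l)))
        + ?E (\<lambda>\<omega>. \<xi> \<omega> ^ (2 * p)) * (cosh_tail p (t * d) / d ^ (2 * p))"
    using pow_int g_int by simp
  also have "\<dots> \<le> ?E (\<lambda>_. 1) + (\<Sum>l=1..p - 1. (\<mu> (2 * l) * ?E (\<lambda>_. 1)) * (?b l / d ^ (2 * l)))
        + (\<mu> (2 * p) * ?E (\<lambda>_. 1)) * (cosh_tail p (t * d) / d ^ (2 * p))"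
  proof -
    have "?E (\<lambda>\<omega>. \<xi> \<omega> ^ (2 * l)) \<le> \<mu> (2 * l) * ?E (\<lambda>_. 1)" if "l \<in> {1..p}" for l
      using integral_mult_le_of_cond_exp_le[OF g g_nonneg g_int _ pow_int mom[OF that]] by simp
    then show ?thesis
      using p d by (intro add_mono sum_mono mult_right_mono order_refl)
        (auto simp: cosh_tail_nonneg power_mult)
  qed
  also have "\<dots> = cosh_moment_bound p (\<lambda>j. \<mu> j / d ^ j) (t * d) * (\<integral>\<omega>. g \<omega> \<partial>M)"
    unfolding cosh_moment_bound_altdef[OF p]
    by (simp add: distrib_left distrib_right sum_distrib_left sum_distrib_right mult_ac)
  finally show "(\<integral>\<omega>. g \<omega> * exp (t * \<xi> \<omega>) \<partial>M)
      \<le> cosh_moment_bound p (\<lambda>j. \<mu> j / d ^ j) (t * d) * (\<integral>\<omega>. g \<omega> \<partial>M)" .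
qed

end

section \<open>A maximal inequality for supermartingales\<close>

text \<open>The quantity \<open>E [Y k; A\<^sup>c] + c * P A\<close>, where \<open>A\<close> is the event that the level \<open>c\<close> has been reached
  by time \<open>k\<close>, is the expectation of the process that is
  frozen at the value \<open>c\<close> from the first passage on. It does not increase with \<open>k\<close>: replacing \<open>Y\<close>
  by \<open>c\<close> at the passage cannot raise it, and before the passage the supermartingale property applies, as \<open>A\<^sup>c\<close> belongs to \<open>F k\<close>. This replaces optional
  stopping. The supermartingale property is stated by integrals over past events.\<close>

lemma (in prob_space) nonneg_supermartingale_maximal_inequality:
  fixes Y :: "nat \<Rightarrow> 'a \<Rightarrow> real"
  assumes filt: "filtration (space M) F" and sub: "\<And>k. subalgebra M (F k)"
    and Y: "\<And>k. Y k \<in> borel_measurable (F k)"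
    and nonneg: "\<And>k \<omega>. Y k \<omega> \<ge> 0"
    and int: "\<And>k. integrable M (Y k)"
    and super: "\<And>k A. A \<in> sets (F k) \<Longrightarrow>
      (\<integral>\<omega>. indicator A \<omega> * Y (Suc k) \<omega> \<partial>M) \<le> (\<integral>\<omega>. indicator A \<omega> * Y k \<omega> \<partial>M)"
    and c: "c > 0"
  shows "c * prob {\<omega> \<in> space M. \<exists>j\<le>n. Y j \<omega> \<ge> c} \<le> expectation (Y 0)"
proof -
  interpret filtration "space M" F by (rule filt)
  define A where "A k = {\<omega> \<in> space M. \<exists>j\<le>k. Y j \<omega> \<ge> c}" for k
  have YF: "Y j \<in> borel_measurable (F k)" if "j \<le> k" for j k
    using Y[of j] sets_F_mono[OF that] measurable_mono[of borel borel "F j" "F k"] space_F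
    by (auto simp: subset_eq)
  have AF: "A k \<in> sets (F k)" for k
  proof -
    have "A k = (\<Union>j\<le>k. {\<omega> \<in> space (F k). Y j \<omega> \<ge> c})"
      by (auto simp: A_def space_F)
    also have "\<dots> \<in> sets (F k)"
      using YF by (intro sets.finite_UN) auto
    finally show ?thesis .
  qed
  have AM[measurable]: "A k \<in> sets M" for k
    using AF sub unfolding subalgebra_def by blast
  have YM[measurable]: "Y k \<in> borel_measurable M" for k
    using int by auto
  have int_ind: "integrable M (\<lambda>\<omega>. indicator B \<omega> * Y k \<omega>)" if "B \<in> sets M" for B k
    using integrable_real_mult_indicator[OF that int[of k]] by (simp add: mult.commute)
  have int_V: "integrable M (\<lambda>\<omega>. indicator (space M - A k) \<omega> * Y l \<omega> + c * indicator (A k) \<omega>)" for k l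
    using int_ind by (intro Bochner_Integration.integrable_add) (auto simp: less_top[symmetric])
  let ?V = "\<lambda>k. (\<integral>\<omega>. indicator (space M - A k) \<omega> * Y k \<omega> \<partial>M) + c * prob (A k)"
  have V_eq: "(\<integral>\<omega>. indicator (space M - A k) \<omega> * Y l \<omega> \<partial>M) + c * prob (A k)
      = (\<integral>\<omega>. indicator (space M - A k) \<omega> * Y l \<omega> + c * indicator (A k) \<omega> \<partial>M)" for k l
    using int_ind by (subst Bochner_Integration.integral_add) (auto simp: less_top[symmetric])
  have "?V k \<le> expectation (Y 0)" for k
  proof (induction k)
    case 0
    show ?case unfolding V_eq
      by (rule integral_mono[OF int_V int]) (auto simp: A_def nonneg split: split_indicator)
  next
    case (Suc k)
    have "?V (Suc k) \<le> (\<integral>\<omega>. indicator (space M - A k) \<omega> * Y (Suc k) \<omega> \<partial>M) + c * prob (A k)"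
      unfolding V_eq
    proof (rule integral_mono[OF int_V int_V])
      fix \<omega> assume "\<omega> \<in> space M"
      then show "indicator (space M - A (Suc k)) \<omega> * Y (Suc k) \<omega> + c * indicator (A (Suc k)) \<omega>
          \<le> indicator (space M - A k) \<omega> * Y (Suc k) \<omega> + c * indicator (A k) \<omega>"
        by (auto simp: A_def le_Suc_eq split: split_indicator)
    qed
    also have "\<dots> \<le> ?V k"
      using super[of "space M - A k" k] AF[of k] space_F[of k] sets.compl_sets[OF AF[of k]] by simp
    finally show ?case using Suc.IH by linarith
  qed
  moreover have "(\<integral>\<omega>. indicator (space M - A n) \<omega> * Y n \<omega> \<partial>M) \<ge> 0"
    by (intro integral_nonneg_AE) (auto simp: nonneg)
  ultimately show ?thesis
    unfolding A_def[symmetric] by (meson add_increasing order_trans order_refl)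
qed

section \<open>The bound for conditionally symmetric martingales\<close>

context cond_symmetric_martingale
begin

text \<open>The sign of \<open>t\<close> is unrestricted, so the lemma covers upward and downward deviations alike.\<close>

lemma one_sided_maximal_inequality:
  fixes \<mu> :: "nat \<Rightarrow> real"
  assumes d: "d > 0" and p: "p \<ge> 1"
    and \<mu>_nonneg: "\<And>l. l \<in> {1..p} \<Longrightarrow> \<mu> (2 * l) \<ge> 0"
    and jumps: "\<And>k. AE \<omega> in M. \<bar>X (Suc k) \<omega> - X k \<omega>\<bar> \<le> d"
    and moments: "\<And>k l. l \<in> {1..p} \<Longrightarrow>
      AE \<omega> in M. real_cond_exp M (F k) (\<lambda>\<omega>. (X (Suc k) \<omega> - X k \<omega>) ^ (2 * l)) \<omega> \<le> \<mu> (2 * l)"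
  shows "prob {\<omega> \<in> space M. \<exists>k\<le>n. t * (X k \<omega> - X 0 \<omega>) \<ge> a}
    \<le> exp (- a) * cosh_moment_bound p (\<lambda>j. \<mu> j / d ^ j) (t * d) ^ n"
proof -
  define B where "B = cosh_moment_bound p (\<lambda>j. \<mu> j / d ^ j) (t * d)"
  have B: "B \<ge> 1"
    unfolding B_def using \<mu>_nonneg d p by (intro cosh_moment_bound_ge_1) auto
  define Y where "Y k \<omega> = exp (t * (X k \<omega> - X 0 \<omega>)) / B ^ k" for k \<omega>
  have XF[measurable]: "X j \<in> borel_measurable (F k)" if "j \<le> k" for j k
    using adapted[of j] sets_F_mono[OF that] measurable_mono[of borel borel "F j" "F k"] space_F
    by (auto simp: subset_eq)
  have YF[measurable]: "Y k \<in> borel_measurable (F k)" for k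
    unfolding Y_def using XF[of k k] XF[of 0 k] by measurable
  have Y_nonneg: "Y k \<omega> \<ge> 0" for k \<omega>
    using B by (simp add: Y_def)
  have Y_Suc: "Y (Suc k) \<omega> = Y k \<omega> * exp (t * (X (Suc k) \<omega> - X k \<omega>)) / B" for k \<omega>
  proof -
    have "t * (X (Suc k) \<omega> - X 0 \<omega>) = t * (X k \<omega> - X 0 \<omega>) + t * (X (Suc k) \<omega> - X k \<omega>)"
      by (simp add: algebra_simps)
    then show ?thesis by (simp only: Y_def exp_add) simp
  qed
  have XM[measurable]: "X k \<in> borel_measurable M" for k
    using integrable_X by auto
  have sigma: "sigma_finite_subalgebra M (F k)" for k
  proof -
    interpret finite_measure_subalgebra M "F k" by unfold_locales (rule subalgebra_F)
    show ?thesis by unfold_locales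
  qed
  have sym: "same_cond_law M (F k) (\<lambda>\<omega>. X (Suc k) \<omega> - X k \<omega>) (\<lambda>\<omega>. - (X (Suc k) \<omega> - X k \<omega>))" for k
    using cond_symmetric[of "Suc k"] by simp
  note step = sigma_finite_subalgebra.integral_exp_symmetric_le[OF sigma sym _ d jumps p moments]
  have Y_int: "integrable M (Y k)" for k
  proof (induction k)
    case 0
    show ?case by (simp add: Y_def)
  next
    case (Suc k)
    show ?case unfolding Y_Suc
      by (intro integrable_divide step(1) Suc YF Y_nonneg) auto
  qed
  have super: "(\<integral>\<omega>. indicator A \<omega> * Y (Suc k) \<omega> \<partial>M) \<le> (\<integral>\<omega>. indicator A \<omega> * Y k \<omega> \<partial>M)"
    if A[measurable]: "A \<in> sets (F k)" for A k
  proof -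
    have AM: "A \<in> sets M" using A subalgebra_F unfolding subalgebra_def by blast
    have "(\<integral>\<omega>. (indicator A \<omega> * Y k \<omega>) * exp (t * (X (Suc k) \<omega> - X k \<omega>)) \<partial>M)
        \<le> B * (\<integral>\<omega>. indicator A \<omega> * Y k \<omega> \<partial>M)"
      unfolding B_def
    proof (rule step(2))
      show "integrable M (\<lambda>\<omega>. indicator A \<omega> * Y k \<omega>)"
        using integrable_real_mult_indicator[OF AM Y_int] by (simp add: mult.commute)
    qed (auto simp: Y_nonneg)
    then show ?thesis
      using B by (simp add: Y_Suc field_simps)
  qed
  define c where "c = exp a / B ^ n"
  have c: "c > 0" using B by (simp add: c_def)
  \<comment> \<open>A deviation \<open>a\<close> at time \<open>k\<close> lifts \<open>Y k\<close> at least to \<open>exp a / B ^ k\<close>, which is smallest for \<open>k = n\<close>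
    because \<open>B \<ge> 1\<close>.\<close>
  have "{\<omega> \<in> space M. \<exists>k\<le>n. t * (X k \<omega> - X 0 \<omega>) \<ge> a} \<subseteq> {\<omega> \<in> space M. \<exists>k\<le>n. Y k \<omega> \<ge> c}"
  proof safe
    fix \<omega> k assume k: "k \<le> n" and "a \<le> t * (X k \<omega> - X 0 \<omega>)"
    then have "exp a / B ^ n \<le> exp (t * (X k \<omega> - X 0 \<omega>)) / B ^ k"
      using B by (intro frac_le power_increasing) auto
    then show "\<exists>k\<le>n. Y k \<omega> \<ge> c" using k by (auto simp: c_def Y_def)
  qed
  moreover have "{\<omega> \<in> space M. \<exists>k\<le>n. Y k \<omega> \<ge> c} \<in> events"
    using Y_int by (auto intro!: borel_measurable_integrable)
  ultimately have "prob {\<omega> \<in> space M. \<exists>k\<le>n. t * (X k \<omega> - X 0 \<omega>) \<ge> a}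
      \<le> prob {\<omega> \<in> space M. \<exists>k\<le>n. Y k \<omega> \<ge> c}"
    by (rule finite_measure_mono)
  also have "\<dots> \<le> expectation (Y 0) / c"
    using nonneg_supermartingale_maximal_inequality[OF filtration_axioms subalgebra_F YF Y_nonneg Y_int super c]
      c by (simp add: field_simps)
  also have "Y 0 = (\<lambda>_. 1)"
    by (simp add: Y_def fun_eq_iff)
  also have "expectation (\<lambda>_. 1) / c = 1 / c"
    by (simp add: prob_space)
  also have "1 / c = exp (- a) * B ^ n"
    by (simp add: c_def exp_minus field_simps)
  finally show ?thesis unfolding B_def .
qed

end

theorem theorem3:
  fixes M :: "'a measure" and F :: "nat \<Rightarrow> 'a measure" and X :: "nat \<Rightarrow> 'a \<Rightarrow> real"
    and m n :: nat and d \<alpha> :: real and \<mu> :: "nat \<Rightarrow> real"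
  assumes mart: "cond_symmetric_martingale M F X"
    and m: "m \<ge> 2" "even m"
    and d: "d > 0"
    and \<mu>_nonneg: "\<And>l. l \<in> {2..m} \<Longrightarrow> even l \<Longrightarrow> \<mu> l \<ge> 0"
    and jumps: "AE \<omega> in M. \<forall>k\<ge>1. \<bar>X k \<omega> - X (k - 1) \<omega>\<bar> \<le> d"
    and moments: "AE \<omega> in M. \<forall>k\<ge>1. \<forall>l\<in>{2..m}. even l \<longrightarrow>
      real_cond_exp M (F (k - 1)) (\<lambda>\<omega>. (X k \<omega> - X (k - 1) \<omega>) ^ l) \<omega> \<le> \<mu> l"
    and \<alpha>: "\<alpha> \<ge> 0"
    and n: "n \<ge> 1"
  shows "let \<delta> = \<alpha> / d; \<gamma> = (\<lambda>j. \<mu> j / d ^ j) in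
    \<P>(\<omega> in M. (MAX k\<in>{1..n}. \<bar>X k \<omega> - X 0 \<omega>\<bar>) \<ge> \<alpha> * real n)
    \<le> 2 * (INF x\<in>{0..}. exp (- \<delta> * x) *
        (1 + (\<Sum>l=1..m div 2 - 1. (\<gamma> (2 * l) - \<gamma> m) * x ^ (2 * l) / fact (2 * l))
           + \<gamma> m * (cosh x - 1))) ^ n"
proof -
  interpret cond_symmetric_martingale M F X by (rule mart)
  define p where "p = m div 2"
  have m_eq: "m = 2 * p" and p: "p \<ge> 1" using m by (auto simp: p_def)
  define \<gamma> where "\<gamma> j = \<mu> j / d ^ j" for j
  let ?P = "\<P>(\<omega> in M. (MAX k\<in>{1..n}. \<bar>X k \<omega> - X 0 \<omega>\<bar>) \<ge> \<alpha> * real n)"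
  let ?f = "\<lambda>x. exp (- (\<alpha> / d) * x) * cosh_moment_bound p \<gamma> x"
  have \<mu>_nonneg': "\<mu> (2 * l) \<ge> 0" if "l \<in> {1..p}" for l
    using that by (intro \<mu>_nonneg) (auto simp: m_eq)
  have jumps': "AE \<omega> in M. \<bar>X (Suc k) \<omega> - X k \<omega>\<bar> \<le> d" for k
    using jumps by eventually_elim (auto dest: spec[of _ "Suc k"])
  have moments': "AE \<omega> in M. real_cond_exp M (F k) (\<lambda>\<omega>. (X (Suc k) \<omega> - X k \<omega>) ^ (2 * l)) \<omega> \<le> \<mu> (2 * l)"
    if "l \<in> {1..p}" for k l
    using moments
  proof eventually_elim
    case (elim \<omega>)
    then show ?case using that by (auto dest!: spec[of _ "Suc k"] bspec[of _ _ "2 * l"] simp: m_eq)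
  qed
  have bound: "?P \<le> 2 * ?f x ^ n" if x: "x \<ge> 0" for x
  proof -
    define t where "t = x / d"
    have t: "t \<ge> 0" "t * d = x" using x d by (auto simp: t_def)
    let ?A = "\<lambda>s. {\<omega> \<in> space M. \<exists>k\<le>n. s * (X k \<omega> - X 0 \<omega>) \<ge> t * (\<alpha> * real n)}"
    have XM[measurable]: "X k \<in> borel_measurable M" for k
      using integrable_X by auto
    have A_meas: "?A s \<in> events" for s by measurable
    have even_bound: "cosh_moment_bound p \<gamma> (- x) = cosh_moment_bound p \<gamma> x"
      by (simp add: cosh_moment_bound_def)
    have A_le: "prob (?A s) \<le> ?f x ^ n" if "s = t \<or> s = - t" for s
    proof -
      have "prob (?A s) \<le> exp (- (t * (\<alpha> * real n))) * cosh_moment_bound p \<gamma> (s * d) ^ n"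
        unfolding \<gamma>_def by (rule one_sided_maximal_inequality[OF d p \<mu>_nonneg' jumps' moments'])
      also have "cosh_moment_bound p \<gamma> (s * d) = cosh_moment_bound p \<gamma> x"
        using that t(2) even_bound by auto
      also have "exp (- (t * (\<alpha> * real n))) = exp (- (\<alpha> / d) * x) ^ n"
        by (simp add: t_def exp_of_nat_mult[symmetric] mult_ac)
      finally show ?thesis by (simp add: power_mult_distrib)
    qed
    have "{\<omega> \<in> space M. (MAX k\<in>{1..n}. \<bar>X k \<omega> - X 0 \<omega>\<bar>) \<ge> \<alpha> * real n} \<subseteq> ?A t \<union> ?A (- t)"
    proof
      fix \<omega> assume *: "\<omega> \<in> {\<omega> \<in> space M. (MAX k\<in>{1..n}. \<bar>X k \<omega> - X 0 \<omega>\<bar>) \<ge> \<alpha> * real n}"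
      then obtain k where k: "k \<in> {1..n}" "\<bar>X k \<omega> - X 0 \<omega>\<bar> \<ge> \<alpha> * real n"
        using n by (auto simp: Max_ge_iff)
      from k(2) have "t * (\<alpha> * real n) \<le> t * \<bar>X k \<omega> - X 0 \<omega>\<bar>"
        using t(1) by (rule mult_left_mono)
      then have "t * (\<alpha> * real n) \<le> t * (X k \<omega> - X 0 \<omega>) \<or> t * (\<alpha> * real n) \<le> - t * (X k \<omega> - X 0 \<omega>)"
        by (auto simp: abs_if algebra_simps split: if_splits)
      then show "\<omega> \<in> ?A t \<union> ?A (- t)" using k(1) * by auto
    qed
    then have "?P \<le> prob (?A t \<union> ?A (- t))"
      using A_meas by (intro finite_measure_mono) auto
    also have "\<dots> \<le> prob (?A t) + prob (?A (- t))"
      using A_meas by (intro measure_Un_le) auto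
    also have "\<dots> \<le> ?f x ^ n + ?f x ^ n"
      by (intro add_mono A_le) simp_all
    finally show ?thesis by simp
  qed
  have f_nonneg: "?f x \<ge> 0" for x
    using cosh_moment_bound_ge_1[OF p, of \<gamma> x] \<mu>_nonneg' d by (auto simp: \<gamma>_def)
  \<comment> \<open>The infimum stands inside the \<open>n\<close>-th power, so the pointwise bounds are compared with it after
    taking \<open>n\<close>-th roots.\<close>
  define q where "q = root n (?P / 2)"
  have q: "q \<ge> 0" "q ^ n = ?P / 2"
    using n by (auto simp: q_def)
  have "q \<le> ?f x" if "x \<ge> 0" for x
  proof (rule power_le_imp_le_base[of _ "n - 1"])
    show "q ^ Suc (n - 1) \<le> ?f x ^ Suc (n - 1)"
      using bound[OF that] q(2) n by simp
  qed (rule f_nonneg)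
  then have "q \<le> (INF x\<in>{0..}. ?f x)"
    by (intro cINF_greatest) auto
  then have "?P \<le> 2 * (INF x\<in>{0..}. ?f x) ^ n"
    using power_mono[OF _ q(1), of _ n] q(2) by fastforce
  then show ?thesis
    unfolding Let_def p_def[symmetric] by (simp add: m_eq cosh_moment_bound_def \<gamma>_def)
qed

end
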